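(* Let $\mathcal R_3=\{(0^m1^n2^k,3^m): m,n,k\ge0,\ n\neq k\ \wedge\ (m=k\vee m=n)\}\subseteq\{0,1,2\}^*\times\{3\}^*$. For every $\varepsilon$ with $0<\varepsilon<1/14$, $\mathcal R_3$ can be computed by a quantum finite state transducer with probability $4/7-\varepsilon$.
   Context: A quantum finite state transducer (qfst) is a tuple $T=(Q,\Sigma_1,\Sigma_2,V,f,q_0,Q_{\rm acc},Q_{\rm rej})$ with $Q$ a finite set of states, $\Sigma_1,\Sigma_2$ finite input/output alphabets, $q_0\in Q$, and disjoint sets $Q_{\rm acc},Q_{\rm rej}\subseteq Q$ of accepting and rejecting states; $Q_{\rm non}$ is the set of remaining states. For each $a\in\Sigma_1\cup\{\ddagger,\$\}$ (end markers) there is a unitary $V_a$ on $\ell^2(Q)$, $V_a|q\rangle=\sum_p (V_a)_{qp}|p\rangle$, and an output function $f_a:Q\to\Sigma_2^*$; $V_\$$ maps $\mathrm{span}\,Q_{\rm non}$ into $\mathrm{span}(Q_{\rm acc}\cup Q_{\rm rej})$. On input $v$ the machine reads $\ddagger v\$$. Its non-halting part is a vector $\psi=\sum_{q,w}\alpha_{qw}|q\rangle\otimes|w\rangle\in\ell^2(Q\times\Sigma_2^* )$, initially $|q_0\rangle\otimes|\epsilon\rangle$. Reading $a$ maps $\psi$ to $\psi'=\sum_{q,w}\alpha_{qw}V_a|q\rangle\otimes|w f_a(q)\rangle$; then for each $x$ the squared norm of the component of $\psi'$ on $\mathrm{span}(Q_{\rm acc})\otimes|x\rangle$ is added to the probability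 of accepting with output $x$, the squared norm of the component on $\mathrm{span}(Q_{\rm rej})\otimes\ell^2(\Sigma_2^* )$ to the rejection probability, and the computation continues with the projection of $\psi'$ onto $\mathrm{span}(Q_{\rm non})\otimes\ell^2(\Sigma_2^* )$. $T(w|v)$ is the total probability of accepting with output $w$ on input $v$. For $\alpha>1/2$, $T$ computes $\mathcal R$ with probability $\alpha$ if for all $v,w$: $(v,w)\in\mathcal R\Rightarrow T(w|v)\ge\alpha$ and $(v,w)\notin\mathcal R\Rightarrow T(w|v)\le1-\alpha$. *)

theory Defs
  imports Complex_Main
begin

datatype 'a tsym = Sym 'a | LEnd | REnd

text \<open>A quantum finite state transducer. States, input and output letters are natural
numbers; the state set, alphabets and accepting/rejecting sets are explicit finite sets.
\<open>V a q p\<close> is the matrix entry \<open>(V_a)_{qp}\<close>, i.e. \<open>V_a |q> = \<Sum>_p (V_a)_{qp} |p>\<close>;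
\<open>out a q\<close> is \<open>f_a(q)\<close>.\<close>
record qfst =
  states :: "nat set"
  in_alph :: "nat set"
  out_alph :: "nat set"
  V :: "nat tsym \<Rightarrow> nat \<Rightarrow> nat \<Rightarrow> complex"
  out :: "nat tsym \<Rightarrow> nat \<Rightarrow> nat list"
  q0 :: nat
  Qacc :: "nat set"
  Qrej :: "nat set"

definition Qnon :: "qfst \<Rightarrow> nat set" where
  "Qnon T = states T - (Qacc T \<union> Qrej T)"

definition tape_syms :: "qfst \<Rightarrow> nat tsym set" where
  "tape_syms T = Sym ` in_alph T \<union> {LEnd, REnd}"

text \<open>Unitarity of a square matrix indexed by a finite set \<open>Q\<close>: \<open>U U^* = I\<close>
(for finite square matrices equivalent to \<open>U^* U = I\<close>).\<close>
definition unitary_on :: "nat set \<Rightarrow> (nat \<Rightarrow> nat \<Rightarrow> complex) \<Rightarrow> bool" where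
  "unitary_on Q U \<longleftrightarrow>
     (\<forall>q\<in>Q. \<forall>q'\<in>Q. (\<Sum>p\<in>Q. U q p * cnj (U q' p)) = (if q = q' then 1 else 0))"

definition is_qfst :: "qfst \<Rightarrow> bool" where
  "is_qfst T \<longleftrightarrow>
     finite (states T) \<and> finite (in_alph T) \<and> finite (out_alph T) \<and>
     q0 T \<in> states T \<and> Qacc T \<subseteq> states T \<and> Qrej T \<subseteq> states T \<and>
     Qacc T \<inter> Qrej T = {} \<and>
     (\<forall>a\<in>tape_syms T. unitary_on (states T) (V T a)) \<and>
     (\<forall>a\<in>tape_syms T. \<forall>q\<in>states T. set (out T a q) \<subseteq> out_alph T) \<and>
     (\<forall>q\<in>Qnon T. \<forall>p\<in>Qnon T. V T REnd q p = 0)"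

text \<open>Non-halting part \<open>\<psi> = \<Sum> \<alpha>_{qw} |q> \<otimes> |w>\<close>, represented by its coefficients.\<close>
type_synonym amp = "nat \<Rightarrow> nat list \<Rightarrow> complex"

text \<open>\<open>\<psi>' = \<Sum>_{q,w} \<alpha>_{qw} V_a|q> \<otimes> |w f_a(q)>\<close>: coefficient of \<open>|p> \<otimes> |x>\<close>.\<close>
definition step :: "qfst \<Rightarrow> nat tsym \<Rightarrow> amp \<Rightarrow> amp" where
  "step T a \<psi> = (\<lambda>p x. \<Sum>q\<in>states T.
      if length (out T a q) \<le> length x \<and>
         drop (length x - length (out T a q)) x = out T a q
      then \<psi> q (take (length x - length (out T a q)) x) * V T a q p
      else 0)"

definition acc_prob :: "qfst \<Rightarrow> amp \<Rightarrow> nat list \<Rightarrow> real" where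
  "acc_prob T \<psi> x = (\<Sum>p\<in>Qacc T. (cmod (\<psi> p x))\<^sup>2)"

definition proj_non :: "qfst \<Rightarrow> amp \<Rightarrow> amp" where
  "proj_non T \<psi> = (\<lambda>p x. if p \<in> Qnon T then \<psi> p x else 0)"

fun run :: "qfst \<Rightarrow> nat tsym list \<Rightarrow> amp \<Rightarrow> nat list \<Rightarrow> real" where
  "run T [] \<psi> = (\<lambda>x. 0)"
| "run T (a # as) \<psi> =
     (\<lambda>x. acc_prob T (step T a \<psi>) x + run T as (proj_non T (step T a \<psi>)) x)"

definition init_amp :: "qfst \<Rightarrow> amp" where
  "init_amp T = (\<lambda>q w. if q = q0 T \<and> w = [] then 1 else 0)"

definition out_prob :: "qfst \<Rightarrow> nat list \<Rightarrow> nat list \<Rightarrow> real" where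
  "out_prob T w v = run T (LEnd # map Sym v @ [REnd]) (init_amp T) w"

definition computes_with_prob :: "qfst \<Rightarrow> (nat list \<times> nat list) set \<Rightarrow> real \<Rightarrow> bool" where
  "computes_with_prob T R \<alpha> \<longleftrightarrow> \<alpha> > 1/2 \<and>
     (\<forall>v\<in>lists (in_alph T). \<forall>w\<in>lists (out_alph T).
        ((v, w) \<in> R \<longrightarrow> out_prob T w v \<ge> \<alpha>) \<and>
        ((v, w) \<notin> R \<longrightarrow> out_prob T w v \<le> 1 - \<alpha>))"

definition R3 :: "(nat list \<times> nat list) set" where
  "R3 = {(replicate m 0 @ replicate n 1 @ replicate k 2, replicate m 3) | m n k.
           n \<noteq> k \<and> (m = k \<or> m = n)}"

end

theory Submission
  imports Defs
begin

text \<open>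
On \<open>0\<^sup>m1\<^sup>n2\<^sup>k\<close> the machine runs a superposition of four branches that write \<open>3\<^sup>m\<close>, \<open>3\<^sup>n\<close>, \<open>3\<^sup>k\<close> and
\<open>3\<close> to the power \<open>(n + k) / 2\<close>. Branches that have written the same word interfere at the end
marker. The final measurement accepts along \<open>C + A + B - D\<close> (with suitable weights) and along
\<open>A - B\<close>: one of \<open>A\<close>, \<open>B\<close> meeting \<open>C\<close> raises the probability of \<open>3\<^sup>m\<close> from below \<open>3/7\<close> to above
\<open>4/7\<close>, whereas if \<open>m = n = k\<close> then \<open>A - B\<close> cancels and \<open>D\<close> compensates the surplus in the first
direction.

To make inputs outside \<open>0\<^sup>*1\<^sup>*2\<^sup>*\<close> harmless, branch \<open>C\<close> lives in a four-dimensional space in which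
the letters 0, 1, 2 project onto a line, a plane and a line in general position. The part lost at a
step 0 to 1, 0 to 2 or 1 to 2 is partly accepted at once, with the correct word \<open>3\<^sup>m\<close>; a descent
shrinks the amplitude for good and is never made up for. The vectors come from a numerical
optimisation followed by rounding to integers; they give the bounds \<open>4/7\<close> and \<open>3/7\<close> without any
loss, so that one machine serves every \<open>\<epsilon>\<close>.
\<close>

section \<open>The transducer\<close>

text \<open>
Each letter acts on eight basis states: 0 to 3 carry branch \<open>C\<close>, 4 and 5 are \<open>A\<close> and \<open>B\<close>, and 6, 7
are \<open>D\<close> with the parity of the number of letters 1 and 2 read so far. Letter 0 keeps the line of
\<open>vec0\<close>; letter 1 accepts state 0, rejects \<open>vec1\<close> and keeps the plane orthogonal to both, which
contains the projection of \<open>vec0\<close>; letter 2 accepts states 0 and 2, rejects 3 and keeps 1.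
\<close>

fun swap67 :: "nat \<Rightarrow> nat" where
  "swap67 i = (if i = 6 then 7 else if i = 7 then 6 else i)"

text \<open>\<open>vec1\<close> is orthogonal to \<open>vec0\<close>, and \<open>vec_start\<close>
  begins with three times \<open>vec0\<close>. The denominators used below are squared norms: 1830,
  146, 1082, 2; 27889 = 167^2 is half that of \<open>vec_start\<close>.\<close>

definition vec0 :: "real list" where "vec0 = [18, 31, 16, 17, 0, 0, 0, 0]"
definition vec1 :: "real list" where "vec1 = [0, 7, -4, -9, 0, 0, 0, 0]"
definition vec_end :: "real list" where "vec_end = [0, 29, 0, 0, 6, 6, -13, 0]"
definition vec_diff :: "real list" where "vec_diff = [0, 0, 0, 0, 1, -1, 0, 0]"
definition vec_start :: "real list" where "vec_start = [54, 93, 48, 51, 63, 63, 59, -167]"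

text \<open>
The left end marker is the reflection that exchanges state 7 with the initial superposition
\<open>(54, 93, 48, 51, 63, 63, 59, 0) / 167\<close>.
\<close>

fun keep_mat :: "nat tsym \<Rightarrow> nat \<Rightarrow> nat \<Rightarrow> real" where
  "keep_mat LEnd i j = of_bool (i = j) - vec_start ! i * vec_start ! j / 27889"
| "keep_mat REnd i j = 0"
| "keep_mat (Sym s) i j =
     (if s = 0 then of_bool (i = j \<and> 4 \<le> i) + vec0 ! i * vec0 ! j / 1830
      else if s = 1 then of_bool (swap67 i = j \<and> i \<noteq> 0) - vec1 ! i * vec1 ! j / 146
      else of_bool (swap67 i = j \<and> i \<noteq> 0 \<and> i \<noteq> 2 \<and> i \<noteq> 3))"

fun acc_mat :: "nat tsym \<Rightarrow> nat \<Rightarrow> nat \<Rightarrow> real" where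
  "acc_mat LEnd i j = 0"
| "acc_mat REnd i j = of_bool (i = j \<and> (i = 0 \<or> i = 2))
     + vec_end ! i * vec_end ! j / 1082 + vec_diff ! i * vec_diff ! j / 2"
| "acc_mat (Sym s) i j =
     (if s = 0 then 0 else if s = 1 then of_bool (i = 0 \<and> j = 0)
      else of_bool (i = j \<and> (i = 0 \<or> i = 2)))"

fun rej_mat :: "nat tsym \<Rightarrow> nat \<Rightarrow> nat \<Rightarrow> real" where
  "rej_mat LEnd i j = 0"
| "rej_mat REnd i j = of_bool (i = j) - acc_mat REnd i j"
| "rej_mat (Sym s) i j =
     (if s = 0 then of_bool (i = j \<and> i < 4) - vec0 ! i * vec0 ! j / 1830
      else if s = 1 then vec1 ! i * vec1 ! j / 146
      else of_bool (i = 3 \<and> j = 3))"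

text \<open>
State \<open>i + 8 * c\<close> is the copy of \<open>i\<close> that is non-halting (\<open>c = 0\<close>), accepting (1) or rejecting (2).
Arranging the three matrices in a circulant pattern yields a unitary matrix, because they are a
permutation matrix times three orthogonal projections that sum to the identity.
\<close>

definition block :: "nat tsym \<Rightarrow> nat \<Rightarrow> nat \<Rightarrow> nat \<Rightarrow> real" where
  "block a c = (if c = 0 then keep_mat a else if c = 1 then acc_mat a else rej_mat a)"

lemma block_simps: "block a 0 = keep_mat a" "block a 1 = acc_mat a" "block a 2 = rej_mat a"
  by (simp_all add: block_def)

text \<open>Branch D writes only on leaving state 7, that is on every second letter 1 or 2.\<close>

definition R3_out :: "nat tsym \<Rightarrow> nat \<Rightarrow> nat list" where
  "R3_out a q =
     (if a = Sym 0 \<and> q < 4 \<or> a = Sym 1 \<and> (q = 4 \<or> q = 7) \<or> a = Sym 2 \<and> (q = 5 \<or> q = 7)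
      then [3] else [])"

definition R3_qfst :: qfst where
  "R3_qfst = \<lparr>states = {..<24}, in_alph = {0, 1, 2}, out_alph = {3},
     V = (\<lambda>a q p. of_real (block a ((q div 8 + p div 8) mod 3) (q mod 8) (p mod 8))),
     out = R3_out, q0 = 7, Qacc = {8..<16}, Qrej = {16..<24}\<rparr>"

lemma R3_qfst_simps [simp]:
  "states R3_qfst = {..<24}" "in_alph R3_qfst = {0, 1, 2}" "out_alph R3_qfst = {3}"
  "out R3_qfst = R3_out" "q0 R3_qfst = 7" "Qacc R3_qfst = {8..<16}" "Qrej R3_qfst = {16..<24}"
  "Qnon R3_qfst = {..<8}"
  by (auto simp: R3_qfst_def Qnon_def)

lemma V_R3_qfst:
  "V R3_qfst a q p = of_real (block a ((q div 8 + p div 8) mod 3) (q mod 8) (p mod 8))"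
  by (simp add: R3_qfst_def)

section \<open>Unitarity of the transition matrices\<close>

lemma sum_lessThan_8: "(\<Sum>i<8. f i) = f 0 + f 1 + f 2 + f 3 + f 4 + f 5 + f 6 + f (7::nat)"
  by (simp add: eval_nat_numeral)

lemma all_less_8:
  "(\<forall>i<8. P i) \<longleftrightarrow> P 0 \<and> P 1 \<and> P 2 \<and> P 3 \<and> P 4 \<and> P 5 \<and> P 6 \<and> P (7::nat)"
proof -
  have "i < 8 \<longleftrightarrow> i = 0 \<or> i = 1 \<or> i = 2 \<or> i = 3 \<or> i = 4 \<or> i = 5 \<or> i = 6 \<or> i = 7" for i :: nat
    by presburger
  then show ?thesis by metis
qed

lemma sum_lessThan_24:
  fixes f :: "nat \<Rightarrow> 'a::comm_monoid_add"
  shows "(\<Sum>p<24. f p) = (\<Sum>j<8. f j) + (\<Sum>j<8. f (j + 8)) + (\<Sum>j<8. f (j + 16))"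
proof -
  have "{..<24::nat} = {..<8} \<union> {8..<16} \<union> {16..<24}" by auto
  then have "(\<Sum>p<24. f p) = sum f {..<8} + sum f {8..<16} + sum f {16..<24}"
    by (simp add: sum.union_disjoint disjoint_iff)
  also have "sum f {8..<16} = (\<Sum>j<8. f (j + 8))"
    using sum.shift_bounds_nat_ivl[of f 0 8 8] by (simp add: atLeast0LessThan)
  also have "sum f {16..<24} = (\<Sum>j<8. f (j + 16))"
    using sum.shift_bounds_nat_ivl[of f 0 16 8] by (simp add: atLeast0LessThan)
  finally show ?thesis .
qed

lemma sum_blocks:
  fixes f :: "nat \<Rightarrow> nat \<Rightarrow> 'a::comm_monoid_add"
  shows "(\<Sum>p<24. f (p div 8) (p mod 8)) = (\<Sum>j<8. f 0 j) + (\<Sum>j<8. f 1 j) + (\<Sum>j<8. f 2 j)"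
proof -
  have "(j + 8) div 8 = 1" "(j + 8) mod 8 = j" "(j + 16) div 8 = 2" "(j + 16) mod 8 = j"
    if "j < 8" for j :: nat
    using that by presburger+
  then show ?thesis unfolding sum_lessThan_24 by simp
qed

lemma vec_nth:
  "vec0 ! 0 = 18" "vec0 ! 1 = 31" "vec0 ! 2 = 16" "vec0 ! 3 = 17"
  "vec0 ! 4 = 0" "vec0 ! 5 = 0" "vec0 ! 6 = 0" "vec0 ! 7 = 0"
  "vec1 ! 0 = 0" "vec1 ! 1 = 7" "vec1 ! 2 = -4" "vec1 ! 3 = -9"
  "vec1 ! 4 = 0" "vec1 ! 5 = 0" "vec1 ! 6 = 0" "vec1 ! 7 = 0"
  "vec_end ! 0 = 0" "vec_end ! 1 = 29" "vec_end ! 2 = 0" "vec_end ! 3 = 0"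
  "vec_end ! 4 = 6" "vec_end ! 5 = 6" "vec_end ! 6 = -13" "vec_end ! 7 = 0"
  "vec_diff ! 0 = 0" "vec_diff ! 1 = 0" "vec_diff ! 2 = 0" "vec_diff ! 3 = 0"
  "vec_diff ! 4 = 1" "vec_diff ! 5 = -1" "vec_diff ! 6 = 0" "vec_diff ! 7 = 0"
  "vec_start ! 0 = 54" "vec_start ! 1 = 93" "vec_start ! 2 = 48" "vec_start ! 3 = 51"
  "vec_start ! 4 = 63" "vec_start ! 5 = 63" "vec_start ! 6 = 59" "vec_start ! 7 = -167"
  by (simp_all add: vec0_def vec1_def vec_end_def vec_diff_def vec_start_def)


lemma blocks_orthogonal:
  assumes "a \<in> {Sym 0, Sym 1, Sym 2, LEnd, REnd}"
  shows "\<forall>i<8. \<forall>k<8. (\<Sum>j<8. keep_mat a i j * acc_mat a k j) = 0" (is ?ka)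
    and "\<forall>i<8. \<forall>k<8. (\<Sum>j<8. keep_mat a i j * rej_mat a k j) = 0" (is ?kr)
    and "\<forall>i<8. \<forall>k<8. (\<Sum>j<8. acc_mat a i j * rej_mat a k j) = 0" (is ?ar)
    and "\<forall>i<8. \<forall>k<8. (\<Sum>j<8. keep_mat a i j * keep_mat a k j)
           + (\<Sum>j<8. acc_mat a i j * acc_mat a k j) + (\<Sum>j<8. rej_mat a i j * rej_mat a k j)
         = of_bool (i = k)" (is ?sum)
proof -
  have a: "a = Sym 0 \<or> a = Sym 1 \<or> a = Sym 2 \<or> a = LEnd \<or> a = REnd" using assms by simp
  show ?ka ?kr ?ar ?sum
    using a unfolding all_less_8 sum_lessThan_8
    by (elim disjE; simp add: vec_nth del: One_nat_def)+
qed

text \<open>Two rows in the same block row pair each matrix with itself, giving \<open>diag\<close>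
  up to rotation; rows in different block rows pair distinct matrices throughout.\<close>

lemma circulant_unitary:
  fixes B :: "nat \<Rightarrow> nat \<Rightarrow> nat \<Rightarrow> real"
  assumes off:
      "\<And>i k. i < 8 \<Longrightarrow> k < 8 \<Longrightarrow> (\<Sum>j<8. B 0 i j * B 1 k j) = 0"
      "\<And>i k. i < 8 \<Longrightarrow> k < 8 \<Longrightarrow> (\<Sum>j<8. B 0 i j * B 2 k j) = 0"
      "\<And>i k. i < 8 \<Longrightarrow> k < 8 \<Longrightarrow> (\<Sum>j<8. B 1 i j * B 2 k j) = 0"
    and diag: "\<And>i k. i < 8 \<Longrightarrow> k < 8 \<Longrightarrow>
      (\<Sum>j<8. B 0 i j * B 0 k j) + (\<Sum>j<8. B 1 i j * B 1 k j) + (\<Sum>j<8. B 2 i j * B 2 k j)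
      = of_bool (i = k)"
  shows "unitary_on {..<24} (\<lambda>q p. of_real (B ((q div 8 + p div 8) mod 3) (q mod 8) (p mod 8)))"
  unfolding unitary_on_def
proof (intro ballI)
  fix q q' :: nat assume q: "q \<in> {..<24}" "q' \<in> {..<24}"
  define s s' i k where defs: "s = q div 8" "s' = q' div 8" "i = q mod 8" "k = q' mod 8"
  have ik: "i < 8" "k < 8" by (simp_all add: defs)
  have s: "s = 0 \<or> s = 1 \<or> s = 2" "s' = 0 \<or> s' = 1 \<or> s' = 2"
    using q by (auto simp: defs)
  have off': "(\<Sum>j<8. B 1 i j * B 0 k j) = 0" "(\<Sum>j<8. B 2 i j * B 0 k j) = 0"
      "(\<Sum>j<8. B 2 i j * B 1 k j) = 0"
    using off[OF ik(2,1)] by (simp_all add: mult.commute)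
  have "q = q' \<longleftrightarrow> s = s' \<and> i = k"
    unfolding defs by (metis div_mult_mod_eq)
  moreover have "(\<Sum>p<24. B ((s + p div 8) mod 3) i (p mod 8) * B ((s' + p div 8) mod 3) k (p mod 8))
      = of_bool (s = s' \<and> i = k)"
    unfolding sum_blocks[of "\<lambda>c j. B ((s + c) mod 3) i j * B ((s' + c) mod 3) k j"]
    using s diag[OF ik] off[OF ik] off' by (elim disjE) (simp_all add: add_ac numeral_2_eq_2)
  ultimately have "(\<Sum>p<24. B ((s + p div 8) mod 3) i (p mod 8) * B ((s' + p div 8) mod 3) k (p mod 8))
      = of_bool (q = q')" by simp
  then have "of_real (\<Sum>p<24. B ((s + p div 8) mod 3) i (p mod 8) * B ((s' + p div 8) mod 3) k (p mod 8))
      = (of_bool (q = q') :: complex)" by simp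
  then show "(\<Sum>p\<in>{..<24}. complex_of_real (B ((q div 8 + p div 8) mod 3) (q mod 8) (p mod 8)) *
        cnj (complex_of_real (B ((q' div 8 + p div 8) mod 3) (q' mod 8) (p mod 8))))
      = (if q = q' then 1 else 0)"
    by (simp add: defs)
qed

lemma is_qfst_R3_qfst: "is_qfst R3_qfst"
proof -
  have "unitary_on {..<24} (V R3_qfst a)" if "a \<in> tape_syms R3_qfst" for a
  proof -
    have a: "a \<in> {Sym 0, Sym 1, Sym 2, LEnd, REnd}"
      using that by (auto simp: tape_syms_def)
    show ?thesis
      unfolding V_R3_qfst
      by (rule circulant_unitary) (simp_all add: block_def blocks_orthogonal[OF a, rule_format])
  qed
  moreover have "V R3_qfst REnd q p = 0" if "q < 8" "p < 8" for q p
    using that by (simp add: V_R3_qfst block_def)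
  moreover have "set (R3_out a q) \<subseteq> {3}" for a q
    by (auto simp: R3_out_def)
  moreover have "{8..<16} \<subseteq> {..<24::nat}" "{16..<24} \<subseteq> {..<24::nat}" by auto
  ultimately show ?thesis
    unfolding is_qfst_def R3_qfst_simps by (simp add: disjoint_iff)
qed

section \<open>Configurations\<close>

text \<open>In every reachable amplitude each state carries a single output word.\<close>

definition packet :: "(nat \<Rightarrow> real) \<Rightarrow> (nat \<Rightarrow> nat list) \<Rightarrow> amp" where
  "packet \<alpha> w = (\<lambda>q x. if x = w q then of_real (\<alpha> q) else 0)"

lemma suffix_iff_append:
  "length y \<le> length x \<and> drop (length x - length y) x = y \<and> take (length x - length y) x = w
    \<longleftrightarrow> x = w @ y"
  by (metis append_eq_conv_conj append_take_drop_id diff_add_inverse2 le_add2 length_append)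

lemma step_packet:
  "step T a (packet \<alpha> w) p x =
     (\<Sum>q\<in>states T. if x = w q @ out T a q then of_real (\<alpha> q) * V T a q p else 0)"
  unfolding step_def packet_def suffix_iff_append[symmetric] by (rule sum.cong) simp_all

text \<open>The amplitude lives on copy 0, where the circulant index is just the target copy
  \<open>c\<close>.\<close>

lemma step_R3_qfst:
  assumes "\<And>q. 8 \<le> q \<Longrightarrow> \<alpha> q = 0" and "j < 8" and "c < 3"
  shows "step R3_qfst a (packet \<alpha> w) (j + 8 * c) x =
    of_real (\<Sum>i<8. if x = w i @ R3_out a i then \<alpha> i * block a c i j else 0)"
proof -
  have jc: "(j + 8 * c) div 8 = c" "(j + 8 * c) mod 8 = j" using assms by simp_all
  have "\<alpha> (i + 8) = 0" "\<alpha> (i + 16) = 0" for i using assms(1) by simp_all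
  then have "step R3_qfst a (packet \<alpha> w) (j + 8 * c) x =
      (\<Sum>i<8. if x = w i @ R3_out a i then of_real (\<alpha> i) * V R3_qfst a i (j + 8 * c) else 0)"
    unfolding step_packet R3_qfst_simps sum_lessThan_24 by (simp cong: if_cong)
  also have "\<dots> = (\<Sum>i<8. of_real (if x = w i @ R3_out a i then \<alpha> i * block a c i j else 0))"
    using assms(2,3) by (intro sum.cong) (auto simp: V_R3_qfst jc)
  finally show ?thesis by simp
qed

lemma acc_prob_R3_qfst: "acc_prob R3_qfst \<psi> x = (\<Sum>j<8. (cmod (\<psi> (j + 8 * 1) x))\<^sup>2)"
  unfolding acc_prob_def R3_qfst_simps
  using sum.shift_bounds_nat_ivl[of "\<lambda>p. (cmod (\<psi> p x))\<^sup>2" 0 8 8]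
  by (simp add: atLeast0LessThan)

lemma mat_columns:
  fixes f :: "nat \<Rightarrow> real"
  shows "\<forall>j<8. (\<Sum>i<8. f i * keep_mat (Sym 0) i j) =
      (if j < 4 then vec0 ! j * ((18 * f 0 + 31 * f 1 + 16 * f 2 + 17 * f 3) / 1830) else f j)"
    and "\<forall>j<8. (\<Sum>i<8. f i * keep_mat (Sym 1) i j) =
      (if j = 0 then 0 else if j < 4 then f j - vec1 ! j * ((7 * f 1 - 4 * f 2 - 9 * f 3) / 146)
       else f (swap67 j))"
    and "\<forall>j<8. (\<Sum>i<8. f i * keep_mat (Sym 2) i j) =
      (if j = 0 \<or> j = 2 \<or> j = 3 then 0 else f (swap67 j))"
    and "\<forall>j<8. (\<Sum>i<8. f i * acc_mat (Sym 1) i j) = of_bool (j = 0) * f j"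
    and "\<forall>j<8. (\<Sum>i<8. f i * acc_mat (Sym 2) i j) = of_bool (j = 0 \<or> j = 2) * f j"
    and "\<forall>j<8. (\<Sum>i<8. f i * acc_mat REnd i j) = of_bool (j = 0 \<or> j = 2) * f j
      + vec_end ! j * ((29 * f 1 + 6 * f 4 + 6 * f 5 - 13 * f 6) / 1082) + vec_diff ! j * ((f 4 - f 5) / 2)"
  unfolding all_less_8 sum_lessThan_8
  by (simp_all add: vec_nth field_simps del: One_nat_def)

lemma norm_acc_mat:
  fixes f :: "nat \<Rightarrow> real"
  shows "(\<Sum>j<8. (\<Sum>i<8. f i * acc_mat (Sym 1) i j)\<^sup>2) = (f 0)\<^sup>2" (is ?one)
    and "(\<Sum>j<8. (\<Sum>i<8. f i * acc_mat (Sym 2) i j)\<^sup>2) = (f 0)\<^sup>2 + (f 2)\<^sup>2" (is ?two)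
    and "(\<Sum>j<8. (\<Sum>i<8. f i * acc_mat REnd i j)\<^sup>2) =
      (f 0)\<^sup>2 + (f 2)\<^sup>2 + (29 * f 1 + 6 * f 4 + 6 * f 5 - 13 * f 6)\<^sup>2 / 1082 + (f 4 - f 5)\<^sup>2 / 2" (is ?fin)
proof -
  note cols = mat_columns(4-6)[of f, unfolded all_less_8]
  show ?one
    unfolding sum_lessThan_8[of "\<lambda>j. (_ j)\<^sup>2"] by (simp only: cols) simp
  show ?two
    unfolding sum_lessThan_8[of "\<lambda>j. (_ j)\<^sup>2"] by (simp only: cols) simp
  \<comment> \<open>\<open>s\<close> and \<open>d\<close> are the coordinates along
    \<open>vec_end\<close> and \<open>vec_diff\<close>; these are orthogonal, so the cross terms
    cancel.\<close>
  have "(\<Sum>j<8. (\<Sum>i<8. f i * acc_mat REnd i j)\<^sup>2) = (f 0)\<^sup>2 + (f 2)\<^sup>2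
      + (29 * s)\<^sup>2 + (6 * s + d)\<^sup>2 + (6 * s - d)\<^sup>2 + (13 * s)\<^sup>2"
    if "s = (29 * f 1 + 6 * f 4 + 6 * f 5 - 13 * f 6) / 1082" and "d = (f 4 - f 5) / 2" for s d
    unfolding sum_lessThan_8[of "\<lambda>j. (_ j)\<^sup>2"]
    by (simp only: cols that[symmetric]) (simp add: vec_nth del: One_nat_def)
  from this[OF refl refl] show ?fin
    by (simp add: power2_eq_square field_simps)
qed

text \<open>
The configuration after reading \<open>l\<close> letters 0, \<open>m\<close> letters 1 and \<open>n\<close> letters 2: only the part
\<open>(e, u, a, r)\<close> of branch \<open>C\<close> depends on the order of the letters.
\<close>

definition coeff :: "real \<Rightarrow> real \<Rightarrow> real \<Rightarrow> real \<Rightarrow> nat \<Rightarrow> nat \<Rightarrow> nat \<Rightarrow> real" where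
  "coeff e u a r m n q =
     (if q = 0 then e else if q = 1 then u else if q = 2 then a else if q = 3 then r
      else if q = 4 \<or> q = 5 then 63/167
      else if q = 6 \<and> even (m + n) \<or> q = 7 \<and> odd (m + n) then 59/167 else 0)"

definition outs :: "nat \<Rightarrow> nat \<Rightarrow> nat \<Rightarrow> nat \<Rightarrow> nat list" where
  "outs l m n q =
     replicate (if q < 4 then l else if q = 4 then m else if q = 5 then n else (m + n) div 2) 3"

definition config :: "real \<Rightarrow> real \<Rightarrow> real \<Rightarrow> real \<Rightarrow> nat \<Rightarrow> nat \<Rightarrow> nat \<Rightarrow> amp" where
  "config e u a r l m n = packet (coeff e u a r m n) (outs l m n)"

text \<open>For a fixed word \<open>x\<close>, only states whose extended word is \<open>x\<close>
  interfere. Zeroing the others turns a step into a row vector times a real matrix.\<close>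

definition moved ::
  "nat tsym \<Rightarrow> real \<Rightarrow> real \<Rightarrow> real \<Rightarrow> real \<Rightarrow> nat \<Rightarrow> nat \<Rightarrow> nat \<Rightarrow> nat list \<Rightarrow> nat \<Rightarrow> real" where
  "moved s e u a r l m n x i = (if x = outs l m n i @ R3_out s i then coeff e u a r m n i else 0)"

lemma step_config:
  assumes "j < 8" and "c < 3"
  shows "step R3_qfst s (config e u a r l m n) (j + 8 * c) x =
    of_real (\<Sum>i<8. moved s e u a r l m n x i * block s c i j)"
proof -
  have "moved s e u a r l m n x i * block s c i j =
      (if x = outs l m n i @ R3_out s i then coeff e u a r m n i * block s c i j else 0)" for i
    by (simp add: moved_def)
  then show ?thesis
    unfolding config_def by (subst step_R3_qfst) (use assms in \<open>simp_all add: coeff_def\<close>)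
qed

lemma proj_step_config:
  assumes "\<And>x. \<forall>j<8. (\<Sum>i<8. moved s e u a r l m n x i * keep_mat s i j)
      = (if x = outs l' m' n' j then coeff e' u' a' r' m' n' j else 0)"
  shows "proj_non R3_qfst (step R3_qfst s (config e u a r l m n)) = config e' u' a' r' l' m' n'"
proof (intro ext)
  fix p x
  show "proj_non R3_qfst (step R3_qfst s (config e u a r l m n)) p x = config e' u' a' r' l' m' n' p x"
  proof (cases "p < 8")
    case True
    then have "step R3_qfst s (config e u a r l m n) p x
        = of_real (if x = outs l' m' n' p then coeff e' u' a' r' m' n' p else 0)"
      using step_config[of p 0 s e u a r l m n x] unfolding block_simps assms[rule_format, OF True]
      by simp
    then show ?thesis using True by (simp add: proj_non_def config_def packet_def)
  next
    case False
    then show ?thesis by (simp add: proj_non_def config_def packet_def coeff_def)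
  qed
qed

lemma acc_step_config:
  "acc_prob R3_qfst (step R3_qfst s (config e u a r l m n)) x =
    (\<Sum>j<8. (\<Sum>i<8. moved s e u a r l m n x i * acc_mat s i j)\<^sup>2)"
proof -
  have three: "(1::nat) < 3" by simp
  have "(cmod (step R3_qfst s (config e u a r l m n) (j + 8 * 1) x))\<^sup>2 =
      (\<Sum>i<8. moved s e u a r l m n x i * acc_mat s i j)\<^sup>2" if "j < 8" for j
    unfolding step_config[OF that three] norm_of_real power2_abs by (simp only: block_simps)
  then show ?thesis unfolding acc_prob_R3_qfst by (intro sum.cong) simp_all
qed

section \<open>Effect of each tape symbol on a configuration\<close>

lemma run_config_0:
  fixes e u a r :: real
  defines "k \<equiv> (18 * e + 31 * u + 16 * a + 17 * r) / 1830"
  shows "run R3_qfst (Sym 0 # as) (config e u a r l m n) x =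
    run R3_qfst as (config (18 * k) (31 * k) (16 * k) (17 * k) (Suc l) m n) x"
proof -
  have "\<forall>j<8. (\<Sum>i<8. moved (Sym 0) e u a r l m n x i * keep_mat (Sym 0) i j)
      = (if x = outs (Suc l) m n j then coeff (18 * k) (31 * k) (16 * k) (17 * k) m n j else 0)" for x
    unfolding all_less_8
    by (simp only: mat_columns(1)[of "moved (Sym 0) e u a r l m n x", unfolded all_less_8])
      (intro conjI; simp add: moved_def outs_def R3_out_def coeff_def vec_nth replicate_append_same k_def
        del: One_nat_def)
  then have "proj_non R3_qfst (step R3_qfst (Sym 0) (config e u a r l m n))
      = config (18 * k) (31 * k) (16 * k) (17 * k) (Suc l) m n"
    by (rule proj_step_config)
  then show ?thesis by (simp add: acc_step_config)
qed

lemma run_config_1: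
  fixes e u a r :: real
  defines "h \<equiv> (7 * u - 4 * a - 9 * r) / 146"
  shows "run R3_qfst (Sym 1 # as) (config e u a r l m n) x =
    (if x = replicate l 3 then e\<^sup>2 else 0)
    + run R3_qfst as (config 0 (u - 7 * h) (a + 4 * h) (r + 9 * h) l (Suc m) n) x"
proof -
  have "\<forall>j<8. (\<Sum>i<8. moved (Sym 1) e u a r l m n x i * keep_mat (Sym 1) i j)
      = (if x = outs l (Suc m) n j then coeff 0 (u - 7 * h) (a + 4 * h) (r + 9 * h) (Suc m) n j else 0)" for x
    unfolding all_less_8
    by (simp only: mat_columns(2)[of "moved (Sym 1) e u a r l m n x", unfolded all_less_8])
      (intro conjI; simp add: moved_def outs_def R3_out_def coeff_def vec_nth replicate_append_same h_def field_simps
        del: One_nat_def)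
  then have "proj_non R3_qfst (step R3_qfst (Sym 1) (config e u a r l m n))
      = config 0 (u - 7 * h) (a + 4 * h) (r + 9 * h) l (Suc m) n"
    by (rule proj_step_config)
  moreover have "acc_prob R3_qfst (step R3_qfst (Sym 1) (config e u a r l m n)) x
      = (if x = replicate l 3 then e\<^sup>2 else 0)"
    unfolding acc_step_config norm_acc_mat by (simp add: moved_def outs_def R3_out_def coeff_def)
  ultimately show ?thesis by simp
qed

lemma run_config_2:
  "run R3_qfst (Sym 2 # as) (config e u a r l m n) x =
    (if x = replicate l 3 then e\<^sup>2 + a\<^sup>2 else 0) + run R3_qfst as (config 0 u 0 0 l m (Suc n)) x"
proof -
  have "\<forall>j<8. (\<Sum>i<8. moved (Sym 2) e u a r l m n x i * keep_mat (Sym 2) i j)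
      = (if x = outs l m (Suc n) j then coeff 0 u 0 0 m (Suc n) j else 0)" for x
    unfolding all_less_8
    by (simp only: mat_columns(3)[of "moved (Sym 2) e u a r l m n x", unfolded all_less_8])
      (intro conjI; simp add: moved_def outs_def R3_out_def coeff_def replicate_append_same
        del: One_nat_def)
  then have "proj_non R3_qfst (step R3_qfst (Sym 2) (config e u a r l m n)) = config 0 u 0 0 l m (Suc n)"
    by (rule proj_step_config)
  moreover have "acc_prob R3_qfst (step R3_qfst (Sym 2) (config e u a r l m n)) x
      = (if x = replicate l 3 then e\<^sup>2 + a\<^sup>2 else 0)"
    unfolding acc_step_config norm_acc_mat by (simp add: moved_def outs_def R3_out_def coeff_def)
  ultimately show ?thesis by simp
qed

text \<open>Here 378 = 6 * 63 and 767 = 13 * 59. The test \<open>2 * t = m + n\<close> includes the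
  parity: for odd \<open>m + n\<close> branch D sits in state 7 and is rejected.\<close>

definition final :: "real \<Rightarrow> nat \<Rightarrow> nat \<Rightarrow> nat \<Rightarrow> real" where
  "final u m n t =
     (29 * u + 378/167 * (of_bool (t = m) + of_bool (t = n)) - 767/167 * of_bool (2 * t = m + n))\<^sup>2 / 1082
     + (63/167)\<^sup>2 * (of_bool (t = m) - of_bool (t = n))\<^sup>2 / 2"

lemma run_config_REnd:
  "run R3_qfst [REnd] (config e u a r l m n) (replicate t 3) =
    (if t = l then e\<^sup>2 + a\<^sup>2 + final u m n t else final 0 m n t)"
proof -
  define v where "v = moved REnd e u a r l m n (replicate t 3)"
  have v: "v 0 = of_bool (t = l) * e" "v 1 = of_bool (t = l) * u" "v 2 = of_bool (t = l) * a"
      "v 4 = of_bool (t = m) * (63/167)" "v 5 = of_bool (t = n) * (63/167)"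
    by (simp_all add: v_def moved_def outs_def R3_out_def coeff_def)
  have "t = (m + n) div 2 \<and> even (m + n) \<longleftrightarrow> 2 * t = m + n"
    by presburger
  then have v6: "v 6 = of_bool (2 * t = m + n) * (59/167)"
    by (auto simp: v_def moved_def outs_def R3_out_def coeff_def)
  have lin: "29 * w + 6 * (y * (63/167)) + 6 * (z * (63/167)) - 13 * (d * (59/167))
      = 29 * w + 378/167 * (y + z) - 767/167 * d" for w y z d :: real
    by (simp add: field_simps)
  have sq: "(y * (63/167) - z * (63/167))\<^sup>2 = (63/167)\<^sup>2 * (y - z)\<^sup>2" for y z :: real
    by (simp add: power2_eq_square algebra_simps)
  show ?thesis
    unfolding run.simps acc_step_config norm_acc_mat v_def[symmetric] v v6 lin sq final_def
    by (cases "t = l") simp_all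
qed

lemma run_LEnd:
  "run R3_qfst (LEnd # as) (init_amp R3_qfst) x
    = run R3_qfst as (config (54/167) (93/167) (48/167) (51/167) 0 0 0) x"
proof -
  define \<alpha> :: "nat \<Rightarrow> real" where "\<alpha> q = of_bool (q = 7)" for q
  have init: "init_amp R3_qfst = packet \<alpha> (\<lambda>_. [])"
    by (intro ext) (simp add: init_amp_def packet_def \<alpha>_def)
  have step: "step R3_qfst LEnd (packet \<alpha> (\<lambda>_. [])) (j + 8 * c) x
      = of_real (if x = [] then block LEnd c 7 j else 0)" if "j < 8" "c < 3" for j c x
  proof -
    have "step R3_qfst LEnd (packet \<alpha> (\<lambda>_. [])) (j + 8 * c) x
        = of_real (\<Sum>i<8. if x = [] @ R3_out LEnd i then \<alpha> i * block LEnd c i j else 0)"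
      by (rule step_R3_qfst) (use that in \<open>simp_all add: \<alpha>_def\<close>)
    also have "(\<Sum>i<8. if x = [] @ R3_out LEnd i then \<alpha> i * block LEnd c i j else 0)
        = (if x = [] then block LEnd c 7 j else 0)"
      unfolding sum_lessThan_8 by (simp add: \<alpha>_def R3_out_def)
    finally show ?thesis .
  qed
  have "\<forall>j<8. keep_mat LEnd 7 j = coeff (54/167) (93/167) (48/167) (51/167) 0 0 j"
    unfolding all_less_8 by (simp add: vec_nth coeff_def del: One_nat_def)
  then have keep: "keep_mat LEnd 7 j = coeff (54/167) (93/167) (48/167) (51/167) 0 0 j" if "j < 8" for j
    using that by blast
  have "proj_non R3_qfst (step R3_qfst LEnd (packet \<alpha> (\<lambda>_. [])))
      = config (54/167) (93/167) (48/167) (51/167) 0 0 0"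
  proof (intro ext)
    fix p x
    show "proj_non R3_qfst (step R3_qfst LEnd (packet \<alpha> (\<lambda>_. []))) p x
        = config (54/167) (93/167) (48/167) (51/167) 0 0 0 p x"
    proof (cases "p < 8")
      case True
      then have "step R3_qfst LEnd (packet \<alpha> (\<lambda>_. [])) p x
          = of_real (if x = [] then coeff (54/167) (93/167) (48/167) (51/167) 0 0 p else 0)"
        using step[of p 0 x] unfolding block_simps keep[OF True] by simp
      then show ?thesis using True by (simp add: proj_non_def config_def packet_def outs_def)
    next
      case False
      then show ?thesis by (simp add: proj_non_def config_def packet_def coeff_def)
    qed
  qed
  moreover have "step R3_qfst LEnd (packet \<alpha> (\<lambda>_. [])) (j + 8 * 1) x = 0" if "j < 8" for j
    using step[OF that, of 1 x] unfolding block_simps by simp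
  then have "acc_prob R3_qfst (step R3_qfst LEnd (packet \<alpha> (\<lambda>_. []))) x = 0"
    unfolding acc_prob_R3_qfst by (intro sum.neutral) simp
  ultimately show ?thesis by (simp add: init)
qed

section \<open>Acceptance probabilities\<close>

definition prob :: "real \<Rightarrow> real \<Rightarrow> real \<Rightarrow> real \<Rightarrow> nat \<Rightarrow> nat \<Rightarrow> nat \<Rightarrow> nat list \<Rightarrow> nat \<Rightarrow> real" where
  "prob e u a r l m n v t = run R3_qfst (map Sym v @ [REnd]) (config e u a r l m n) (replicate t 3)"

lemma prob_Nil:
  "prob e u a r l m n [] t = (if t = l then e\<^sup>2 + a\<^sup>2 + final u m n t else final 0 m n t)"
  unfolding prob_def list.map append_Nil by (rule run_config_REnd)

lemma prob_0:
  assumes "k = (18 * e + 31 * u + 16 * a + 17 * r) / 1830"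
  shows "prob e u a r l m n (0 # v) t = prob (18 * k) (31 * k) (16 * k) (17 * k) (Suc l) m n v t"
  unfolding prob_def list.map append_Cons assms by (rule run_config_0)

lemma prob_1:
  assumes "h = (7 * u - 4 * a - 9 * r) / 146"
  shows "prob e u a r l m n (1 # v) t =
    (if t = l then e\<^sup>2 else 0) + prob 0 (u - 7 * h) (a + 4 * h) (r + 9 * h) l (Suc m) n v t"
  unfolding prob_def list.map append_Cons assms run_config_1 by simp

lemma prob_2:
  "prob e u a r l m n (2 # v) t =
    (if t = l then e\<^sup>2 + a\<^sup>2 else 0) + prob 0 u 0 0 l m (Suc n) v t"
  unfolding prob_def list.map append_Cons run_config_2 by simp

text \<open>The hypothesis is orthogonality to \<open>vec1\<close>, so letter 1 rejects
  nothing.\<close>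

lemma prob_1_in_plane:
  assumes "7 * u = 4 * a + 9 * r"
  shows "prob e u a r l m n (1 # v) t = (if t = l then e\<^sup>2 else 0) + prob 0 u a r l (Suc m) n v t"
  using prob_1[of 0 u a r e l m n v t] assms by simp

lemma prob_1_after_2:
  "prob 0 u 0 0 l m n (1 # v) t = prob 0 (97/146 * u) (28/146 * u) (63/146 * u) l (Suc m) n v t"
  using prob_1[of "7/146 * u" u 0 0 0 l m n v t] by (simp add: algebra_simps)

section \<open>Bounds for the end measurement\<close>

lemma final_accepting:
  assumes "m \<noteq> n" and "t = m \<or> t = n"
  shows "final u m n t = (29 * u + 378/167)\<^sup>2 / 1082 + (63/167)\<^sup>2 / 2"
  using assms by (auto simp: final_def)

text \<open>The three bounds cover the cases where none of A, B, D has written the word, where only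
  D has, and where all three have: 2 * 378 - 767 = -11.\<close>

lemma final_rejecting_le:
  assumes "\<not> (m \<noteq> n \<and> (t = m \<or> t = n))"
    and "(29 * u)\<^sup>2 / 1082 \<le> M" "(29 * u - 767/167)\<^sup>2 / 1082 \<le> M" "(29 * u - 11/167)\<^sup>2 / 1082 \<le> M"
  shows "final u m n t \<le> M"
  using assms by (cases "t = m"; cases "2 * t = m + n") (auto simp: final_def)

lemma final_le:
  assumes "(29 * u)\<^sup>2 / 1082 \<le> M" "(29 * u - 767/167)\<^sup>2 / 1082 \<le> M" "(29 * u - 11/167)\<^sup>2 / 1082 \<le> M"
    and "(29 * u + 378/167)\<^sup>2 / 1082 + (63/167)\<^sup>2 / 2 \<le> M"
  shows "final u m n t \<le> M"
  using assms final_accepting[of m n t u] final_rejecting_le[of m n t u M] by metis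

lemma final_0_le: "final 0 m n t \<le> 1/10"
  by (rule final_le) (simp_all add: power2_eq_square)

lemma final_rejecting_bound:
  assumes "\<not> (m \<noteq> n \<and> (t = m \<or> t = n))"
  shows "5220/27889 + final (93/167) m n t \<le> 3/7"
proof -
  have "final (93/167) m n t \<le> 3/7 - 5220/27889"
    by (rule final_rejecting_le[OF assms]) (simp_all add: power2_eq_square)
  then show ?thesis by simp
qed

text \<open>By convexity the quadratic lies below its chord over \<open>[0, B]\<close>.\<close>

lemma quadratic_le_endpoints:
  fixes \<alpha> \<beta> \<gamma> :: real
  assumes "0 \<le> \<alpha>" "0 \<le> u" "u \<le> B" and "\<gamma> \<le> M" and "\<alpha> * B\<^sup>2 + \<beta> * B + \<gamma> \<le> M"
  shows "\<alpha> * u\<^sup>2 + \<beta> * u + \<gamma> \<le> M"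
proof (cases "B = 0")
  case False
  then have B: "0 < B" using assms by simp
  have "u\<^sup>2 \<le> B * u" using assms by (simp add: power2_eq_square mult_right_mono)
  then have "B * (\<alpha> * u\<^sup>2 + \<beta> * u + \<gamma>) \<le> B * (\<alpha> * (B * u) + \<beta> * u + \<gamma>)"
    using assms B by (intro mult_left_mono add_right_mono) auto
  also have "\<dots> = u * (\<alpha> * B\<^sup>2 + \<beta> * B + \<gamma>) + (B - u) * \<gamma>"
    by (simp add: power2_eq_square algebra_simps)
  also have "\<dots> \<le> u * M + (B - u) * M"
    using assms by (intro add_mono mult_left_mono) auto
  also have "\<dots> = B * M" by (simp add: algebra_simps)
  finally show ?thesis using B by (simp only: mult_le_cancel_left_pos)
qed (use assms in auto)

text \<open>Replacing \<open>x\<close> by its bound leaves a quadratic in \<open>u\<close> with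
  leading coefficient 841/1082 - 16/243 > 0, so the endpoints 0 and \<open>B\<close>
  suffice.\<close>

lemma final_bound:
  assumes u: "0 \<le> u" "u \<le> B" and x: "x + 16/243 * u\<^sup>2 \<le> C"
    and "final 0 m n t \<le> 3/7 - C"
    and "final B m n t \<le> 3/7 - C + 16/243 * B\<^sup>2"
  shows "x + final u m n t \<le> 3/7"
proof -
  define c :: real where "c = 378/167 * (of_bool (t = m) + of_bool (t = n)) - 767/167 * of_bool (2 * t = m + n)"
  define d :: real where "d = (63/167)\<^sup>2 * (of_bool (t = m) - of_bool (t = n))\<^sup>2 / 2"
  have final: "final w m n t = (29 * w + c)\<^sup>2 / 1082 + d" for w
    unfolding final_def c_def d_def by (simp only: add_diff_eq)
  have eq: "final w m n t - 16/243 * w\<^sup>2 = 187051/262926 * w\<^sup>2 + (29/541 * c) * w + (c\<^sup>2 / 1082 + d)" for w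
  proof -
    have "(29 * w + c)\<^sup>2 = 841 * w\<^sup>2 + 58 * (c * w) + c\<^sup>2"
      by (simp add: power2_eq_square algebra_simps)
    then show ?thesis unfolding final by (simp add: field_simps)
  qed
  have "187051/262926 * u\<^sup>2 + (29/541 * c) * u + (c\<^sup>2 / 1082 + d) \<le> 3/7 - C"
  proof (rule quadratic_le_endpoints[where B = B])
    show "c\<^sup>2 / 1082 + d \<le> 3/7 - C" using assms(4) unfolding final by simp
    show "187051/262926 * B\<^sup>2 + (29/541 * c) * B + (c\<^sup>2 / 1082 + d) \<le> 3/7 - C"
      using assms(5) eq[of B] by linarith
  qed (use u in auto)
  then show ?thesis using x eq[of u] by linarith
qed

text \<open>
While \<open>l \<noteq> t\<close>, branch \<open>C\<close> does not contribute to the word \<open>3\<^sup>t\<close>.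
\<close>

lemma prob_past:
  assumes "v \<in> lists {0, 1, 2}" and "t < l"
  shows "prob e u a r l m n v t \<le> 1/10"
  using assms
proof (induction v arbitrary: e u a r l m n rule: list.induct)
  case Nil
  then show ?case using final_0_le[of m n t] by (simp add: prob_Nil)
next
  case (Cons b v)
  then consider "b = 0" | "b = 1" | "b = 2" by auto
  then show ?case
  proof cases
    case 1
    then show ?thesis
      unfolding 1 prob_0[OF refl] using Cons.prems by (intro Cons.IH) auto
  next
    case 2
    have "prob e u a r l m n (1 # v) t \<le> 1/10"
      unfolding prob_1[OF refl] using Cons.prems Cons.IH by simp
    then show ?thesis using 2 by simp
  next
    case 3
    then show ?thesis unfolding 3 prob_2 using Cons.prems Cons.IH by simp
  qed
qed

text \<open>
The bound on branch \<open>C\<close> is an invariant: \<open>x + e\<^sup>2 + a\<^sup>2\<close> is what has been accepted once a letter 2 is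
read, letter 2 changes neither this quantity nor \<open>u\<close>, and a descent from 2 to 1 adds \<open>(28/146 * u)\<^sup>2\<close>
to it while multiplying \<open>u\<close> by \<open>97/146\<close>. The coefficient \<open>16/243\<close> is the one for which the two
changes balance.
\<close>

lemma prob_present:
  assumes "v \<in> lists {0, 1, 2}"
    and "7 * u = 4 * a + 9 * r \<or> e = 0 \<and> a = 0 \<and> r = 0"
    and "0 \<le> u" "u \<le> B"
    and "x + e\<^sup>2 + a\<^sup>2 + 16/243 * u\<^sup>2 \<le> C"
    and C: "C \<le> 3/7 - 1/10"
    and B: "\<And>m n. final B m n t \<le> 3/7 - C + 16/243 * B\<^sup>2"
  shows "x + prob e u a r t m n v t \<le> 3/7"
  using assms(1-5)
proof (induction v arbitrary: e u a r m n x rule: list.induct)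
  case Nil
  then have "(x + e\<^sup>2 + a\<^sup>2) + final u m n t \<le> 3/7"
    using final_0_le[of m n t] C by (intro final_bound[where B = B and C = C] B) auto
  then show ?case by (simp add: prob_Nil)
next
  case (Cons b v)
  then consider "b = 0" | "b = 1" "7 * u = 4 * a + 9 * r" | "b = 1" "e = 0" "a = 0" "r = 0" | "b = 2"
    by auto
  then show ?case
  proof cases
    case 1
    \<comment> \<open>One more 0 makes the word of branch C too long; the remaining 1/10 fits
      because of the bound on \<open>C\<close>.\<close>
    have "0 \<le> e\<^sup>2" "0 \<le> a\<^sup>2" "0 \<le> u\<^sup>2" by simp_all
    then have "x \<le> 3/7 - 1/10"
      using Cons.prems(5) C by linarith
    moreover have "prob e u a r t m n (0 # v) t \<le> 1/10"
      unfolding prob_0[OF refl] using Cons.prems by (intro prob_past) auto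
    ultimately show ?thesis using 1 by simp
  next
    case 2
    have "(x + e\<^sup>2) + prob 0 u a r t (Suc m) n v t \<le> 3/7"
      using Cons.prems 2 by (intro Cons.IH) auto
    then show ?thesis using 2 by (simp add: prob_1_in_plane del: One_nat_def)
  next
    case 3
    have "x + prob 0 (97/146 * u) (28/146 * u) (63/146 * u) t (Suc m) n v t \<le> 3/7"
      using Cons.prems 3 by (intro Cons.IH) (auto simp: power2_eq_square)
    then show ?thesis using 3 by (simp add: prob_1_after_2 del: One_nat_def)
  next
    case 4
    have "(x + e\<^sup>2 + a\<^sup>2) + prob 0 u 0 0 t m (Suc n) v t \<le> 3/7"
      using Cons.prems by (intro Cons.IH) auto
    then show ?thesis using 4 by (simp add: prob_2)
  qed
qed

text \<open>
The last premise bounds the component along \<open>vec0\<close>, the only part of branch \<open>C\<close> to survive the next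
letter 0. Leaving the block of initial zeros costs a factor \<open>1506/1830 = 251/305\<close>.
\<close>

lemma prob_future:
  assumes "v \<in> lists {0, 1, 2}" and "l < t"
    and "7 * u = 4 * a + 9 * r \<or> e = 0 \<and> a = 0 \<and> r = 0"
    and "0 \<le> e" "0 \<le> u" "0 \<le> a" "0 \<le> r"
    and "18 * e + 31 * u + 16 * a + 17 * r \<le> 4518/167"
  shows "prob e u a r l m n v t \<le> 3/7"
  using assms
proof (induction v arbitrary: e u a r l m n rule: list.induct)
  case Nil
  then show ?case using final_0_le[of m n t] by (simp add: prob_Nil)
next
  case (Cons b v)
  then consider "b = 0" | "b = 1" "7 * u = 4 * a + 9 * r" | "b = 1" "e = 0" "a = 0" "r = 0" | "b = 2"
    by auto
  then show ?case
  proof cases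
    case 1
    define k where "k = (18 * e + 31 * u + 16 * a + 17 * r) / 1830"
    have k: "0 \<le> k" "k \<le> 753/50935" using Cons.prems by (simp_all add: k_def)
    have "prob (18 * k) (31 * k) (16 * k) (17 * k) (Suc l) m n v t \<le> 3/7"
    proof (cases "Suc l = t")
      case True
      have "k\<^sup>2 \<le> (753/50935)\<^sup>2" using k by (intro power_mono)
      \<comment> \<open>Branch C starts as 3/167 times \<open>vec0\<close>, and 753/50935 = 251/305
        * 3/167: amplitudes shrink by 251/305, the invariant by its square.\<close>
      then have "0 + prob (18 * k) (31 * k) (16 * k) (17 * k) t m n v t \<le> 3/7"
        using Cons.prems k
        by (intro prob_present[where B = "251/305 * (93/167)"
              and C = "(251/305)\<^sup>2 * (5220/27889 + 16/243 * (93/167)\<^sup>2)"] final_le)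
          (simp_all add: power2_eq_square)
      then show ?thesis using True by simp
    next
      case False
      then show ?thesis using Cons.prems k by (intro Cons.IH) auto
    qed
    then show ?thesis using 1 prob_0[OF k_def] by simp
  next
    case 2
    have "prob 0 u a r l (Suc m) n v t \<le> 3/7"
      using Cons.prems 2 by (intro Cons.IH) auto
    then show ?thesis using 2 Cons.prems by (simp add: prob_1_in_plane del: One_nat_def)
  next
    case 3
    \<comment> \<open>As \<open>vec1\<close> is orthogonal to \<open>vec0\<close>, the component
      along \<open>vec0\<close> is unchanged: 31 * 97 + 16 * 28 + 17 * 63 = 31 * 146.\<close>
    have "prob 0 (97/146 * u) (28/146 * u) (63/146 * u) l (Suc m) n v t \<le> 3/7"
      using Cons.prems 3 by (intro Cons.IH) auto
    then show ?thesis using 3 by (simp add: prob_1_after_2 del: One_nat_def)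
  next
    case 4
    have "prob 0 u 0 0 l m (Suc n) v t \<le> 3/7"
      using Cons.prems by (intro Cons.IH) auto
    then show ?thesis using 4 Cons.prems by (simp add: prob_2)
  qed
qed

section \<open>Dichotomy: low probability or membership\<close>

lemma prob_from_2:
  assumes "v \<in> lists {0, 1, 2}"
  shows "5220/27889 + prob 0 (93/167) 0 0 t m n v t \<le> 3/7 \<or>
    (\<exists>k. v = replicate k 2 \<and> m \<noteq> n + k \<and> (t = n + k \<or> t = m))"
  using assms
proof (induction v arbitrary: n rule: list.induct)
  case Nil
  then show ?case
    by (cases "m \<noteq> n \<and> (t = m \<or> t = n)") (use final_rejecting_bound[of m n t] in \<open>auto simp: prob_Nil\<close>)
next
  case (Cons b v)
  then consider "b = 0" | "b = 1" | "b = 2" by auto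
  then show ?case
  proof cases
    case 1
    have "prob 0 (93/167) 0 0 t m n (0 # v) t \<le> 1/10"
      unfolding prob_0[OF refl] using Cons.prems by (intro prob_past) auto
    then show ?thesis using 1 by simp
  next
    case 2
    \<comment> \<open>Here 5220 = 54^2 + 48^2. After the descent the invariant of
      \<open>prob_present\<close> holds with equality, by the choice of 16/243.\<close>
    have "5220/27889 + prob 0 (97/146 * (93/167)) (28/146 * (93/167)) (63/146 * (93/167)) t (Suc m) n v t \<le> 3/7"
      using Cons.prems
      by (intro prob_present[where B = "97/146 * (93/167)" and C = "5220/27889 + 16/243 * (93/167)\<^sup>2"] final_le)
        (simp_all add: power2_eq_square)
    then show ?thesis using 2 by (simp add: prob_1_after_2 del: One_nat_def)
  next
    case 3
    have "prob 0 (93/167) 0 0 t m n (b # v) t = prob 0 (93/167) 0 0 t m (Suc n) v t"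
      using 3 by (simp add: prob_2)
    moreover have "\<exists>k. b # v = replicate k 2 \<and> m \<noteq> n + k \<and> (t = n + k \<or> t = m)"
      if "v = replicate k 2" "m \<noteq> Suc n + k" "t = Suc n + k \<or> t = m" for k
      using that 3 by (intro exI[of _ "Suc k"]) auto
    ultimately show ?thesis using Cons.IH[of "Suc n"] Cons.prems by auto
  qed
qed

lemma prob_from_1:
  assumes "v \<in> lists {0, 1, 2}"
  shows "2916/27889 + prob 0 (93/167) (48/167) (51/167) t m 0 v t \<le> 3/7 \<or>
    (\<exists>i k. v = replicate i 1 @ replicate k 2 \<and> m + i \<noteq> k \<and> (t = k \<or> t = m + i))"
  using assms
proof (induction v arbitrary: m rule: list.induct)
  case Nil
  then show ?case
    by (cases "m \<noteq> 0 \<and> (t = m \<or> t = 0)")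
      (use final_rejecting_bound[of m 0 t] in \<open>auto simp: prob_Nil power2_eq_square\<close>)
next
  case (Cons b v)
  then consider "b = 0" | "b = 1" | "b = 2" by auto
  then show ?case
  proof cases
    case 1
    have "prob 0 (93/167) (48/167) (51/167) t m 0 (0 # v) t \<le> 1/10"
      unfolding prob_0[OF refl] using Cons.prems by (intro prob_past) auto
    then show ?thesis using 1 by simp
  next
    case 2
    have "prob 0 (93/167) (48/167) (51/167) t m 0 (b # v) t = prob 0 (93/167) (48/167) (51/167) t (Suc m) 0 v t"
      using 2 by (simp add: prob_1_in_plane del: One_nat_def)
    moreover have "\<exists>i k. b # v = replicate i 1 @ replicate k 2 \<and> m + i \<noteq> k \<and> (t = k \<or> t = m + i)"
      if "v = replicate i 1 @ replicate k 2" "Suc m + i \<noteq> k" "t = k \<or> t = Suc m + i" for i k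
      using that 2 by (intro exI[of _ "Suc i"] exI[of _ k]) auto
    ultimately show ?thesis using Cons.IH[of "Suc m"] Cons.prems by auto
  next
    case 3
    have "2916/27889 + prob 0 (93/167) (48/167) (51/167) t m 0 (b # v) t
        = 5220/27889 + prob 0 (93/167) 0 0 t m (Suc 0) v t"
      using 3 by (simp add: prob_2 power2_eq_square)
    moreover have "\<exists>i k. b # v = replicate i 1 @ replicate k 2 \<and> m + i \<noteq> k \<and> (t = k \<or> t = m + i)"
      if "v = replicate k 2" "m \<noteq> Suc 0 + k" "t = Suc 0 + k \<or> t = m" for k
      using that 3 by (intro exI[of _ 0] exI[of _ "Suc k"]) auto
    ultimately show ?thesis using prob_from_2[of v t m "Suc 0"] Cons.prems by auto
  qed
qed

text \<open>When the initial zeros end, shorter words are excluded by \<open>prob_past\<close> and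
  longer ones by \<open>prob_future\<close>; only \<open>t = l\<close> can lead to a member.\<close>

lemma prob_from_0:
  assumes "v \<in> lists {0, 1, 2}"
  shows "prob (54/167) (93/167) (48/167) (51/167) l 0 0 v t \<le> 3/7 \<or>
    (\<exists>j i k. v = replicate j 0 @ replicate i 1 @ replicate k 2 \<and> t = l + j \<and> i \<noteq> k \<and> (t = k \<or> t = i))"
  using assms
proof (induction v arbitrary: l rule: list.induct)
  case Nil
  have "prob (54/167) (93/167) (48/167) (51/167) l 0 0 [] t \<le> 3/7"
    using final_rejecting_bound[of 0 0 t] final_0_le[of 0 0 t] by (auto simp: prob_Nil power2_eq_square)
  then show ?case ..
next
  case (Cons b v)
  then have v: "v \<in> lists {0, 1, 2}" by simp
  let ?member = "\<lambda>l v. \<exists>j i k. v = replicate j 0 @ replicate i 1 @ replicate k 2 \<and> t = l + j \<and> i \<noteq> k \<and> (t = k \<or> t = i)"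
  consider "b = 0" | "b = 1" | "b = 2" using Cons.prems by auto
  then show ?case
  proof cases
    case 1
    \<comment> \<open>Branch C is still a multiple of \<open>vec0\<close>, hence fixed by letter
      0.\<close>
    have "prob (54/167) (93/167) (48/167) (51/167) l 0 0 (b # v) t
        = prob (54/167) (93/167) (48/167) (51/167) (Suc l) 0 0 v t"
      using 1 prob_0[of "3/167" "54/167" "93/167" "48/167" "51/167" l 0 0 v t] by simp
    moreover have "?member l (b # v)" if member: "?member (Suc l) v"
    proof -
      obtain j i k where "v = replicate j 0 @ replicate i 1 @ replicate k 2" "t = Suc l + j" "i \<noteq> k" "t = k \<or> t = i"
        using member by blast
      then have "b # v = replicate (Suc j) 0 @ replicate i 1 @ replicate k 2" "t = l + Suc j"
        using 1 by simp_all
      then show ?thesis using \<open>i \<noteq> k\<close> \<open>t = k \<or> t = i\<close> by blast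
    qed
    ultimately show ?thesis using Cons.IH[OF v, of "Suc l"] by metis
  next
    case 2
    have eq: "prob (54/167) (93/167) (48/167) (51/167) l 0 0 (b # v) t
        = (if t = l then 2916/27889 else 0) + prob 0 (93/167) (48/167) (51/167) l (Suc 0) 0 v t"
      using 2 by (simp add: prob_1_in_plane power2_eq_square del: One_nat_def)
    show ?thesis
    proof (cases t l rule: linorder_cases)
      case less
      then show ?thesis
        using prob_past[OF Cons.prems, of t l "54/167" "93/167" "48/167" "51/167" 0 0] by simp
    next
      case equal
      have "?member l (b # v)"
        if member: "\<exists>i k. v = replicate i 1 @ replicate k 2 \<and> Suc 0 + i \<noteq> k \<and> (t = k \<or> t = Suc 0 + i)"
      proof -
        obtain i k where "v = replicate i 1 @ replicate k 2" "Suc i \<noteq> k" "t = k \<or> t = Suc i"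
          using member by auto
        then have "b # v = replicate 0 0 @ replicate (Suc i) 1 @ replicate k 2" "t = l + 0"
          using 2 equal by simp_all
        then show ?thesis using \<open>Suc i \<noteq> k\<close> \<open>t = k \<or> t = Suc i\<close> by blast
      qed
      then show ?thesis using prob_from_1[OF v, of t "Suc 0"] equal unfolding eq by auto
    next
      case greater
      have "prob 0 (93/167) (48/167) (51/167) l (Suc 0) 0 v t \<le> 3/7"
        using greater v by (intro prob_future) simp_all
      then show ?thesis using greater unfolding eq by simp
    qed
  next
    case 3
    have eq: "prob (54/167) (93/167) (48/167) (51/167) l 0 0 (b # v) t
        = (if t = l then 5220/27889 else 0) + prob 0 (93/167) 0 0 l 0 (Suc 0) v t"
      using 3 by (simp add: prob_2 power2_eq_square)
    show ?thesis
    proof (cases t l rule: linorder_cases)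
      case less
      then show ?thesis
        using prob_past[OF Cons.prems, of t l "54/167" "93/167" "48/167" "51/167" 0 0] by simp
    next
      case equal
      have "?member l (b # v)"
        if member: "\<exists>k. v = replicate k 2 \<and> 0 \<noteq> Suc 0 + k \<and> (t = Suc 0 + k \<or> t = 0)"
      proof -
        obtain k where "v = replicate k 2" "t = Suc k \<or> t = 0"
          using member by auto
        then have "b # v = replicate 0 0 @ replicate 0 1 @ replicate (Suc k) 2" "t = l + 0" "0 \<noteq> Suc k"
          using 3 equal by simp_all
        then show ?thesis using \<open>t = Suc k \<or> t = 0\<close> by blast
      qed
      then show ?thesis using prob_from_2[OF v, of t 0 "Suc 0"] equal unfolding eq by auto
    next
      case greater
      have "prob 0 (93/167) 0 0 l 0 (Suc 0) v t \<le> 3/7"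
        using greater v by (intro prob_future) simp_all
      then show ?thesis using greater unfolding eq by simp
    qed
  qed
qed

section \<open>Exact probabilities on sorted inputs\<close>

lemma prob_zeros:
  "prob (54/167) (93/167) (48/167) (51/167) l 0 0 (replicate j 0 @ v) t
    = prob (54/167) (93/167) (48/167) (51/167) (l + j) 0 0 v t"
proof (induction j arbitrary: l)
  case (Suc j)
  then show ?case
    using prob_0[of "3/167" "54/167" "93/167" "48/167" "51/167" l 0 0 "replicate j 0 @ v" t] by simp
qed simp

text \<open>The first 2, or else the end marker, accepts states 0 and 2; later letters find both
  empty.\<close>

lemma prob_twos: "prob e u a r t m n (replicate k 2) t = e\<^sup>2 + a\<^sup>2 + final u m (n + k) t"
  by (induction k arbitrary: e a r n) (simp_all add: prob_Nil prob_2)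

lemma prob_ones_twos:
  assumes "7 * u = 4 * a + 9 * r"
  shows "prob e u a r t m n (replicate i 1 @ replicate k 2) t = e\<^sup>2 + a\<^sup>2 + final u (m + i) (n + k) t"
  using assms
  by (induction i arbitrary: e m) (simp_all add: prob_twos prob_1_in_plane del: One_nat_def)

lemma out_prob_R3_qfst:
  "out_prob R3_qfst (replicate t 3) v = prob (54/167) (93/167) (48/167) (51/167) 0 0 0 v t"
  unfolding out_prob_def run_LEnd prob_def by simp

theorem theorem7:
  fixes \<epsilon> :: real
  assumes "0 < \<epsilon>" and "\<epsilon> < 1/14"
  shows "\<exists>T. is_qfst T \<and> in_alph T = {0, 1, 2} \<and> out_alph T = {3} \<and>
             computes_with_prob T R3 (4/7 - \<epsilon>)"
proof -
  have acc: "4/7 \<le> out_prob R3_qfst w v" if R3: "(v, w) \<in> R3" for v w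
  proof -
    obtain m n k where vw: "v = replicate m 0 @ replicate n 1 @ replicate k 2" "w = replicate m 3"
      and "n \<noteq> k" "m = k \<or> m = n"
      using R3 by (auto simp: R3_def)
    \<comment> \<open>A and B have written \<open>n\<close> and \<open>k\<close> letters; adding
      5220/27889 gives slightly more than 4/7.\<close>
    then have "final (93/167) n k m = (29 * (93/167) + 378/167)\<^sup>2 / 1082 + (63/167)\<^sup>2 / 2"
      by (intro final_accepting) auto
    then show ?thesis
      unfolding vw out_prob_R3_qfst prob_zeros
      by (simp add: prob_ones_twos power2_eq_square del: One_nat_def)
  qed
  have rej: "out_prob R3_qfst w v \<le> 3/7"
    if v: "v \<in> lists {0, 1, 2}" and "w \<in> lists {3}" and notin: "(v, w) \<notin> R3" for v w
  proof -
    have "\<exists>t. w = replicate t 3"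
      using that(2) by (intro exI[of _ "length w"]) (simp add: replicate_length_same in_lists_conv_set)
    then obtain t where w: "w = replicate t 3" by blast
    show ?thesis
      using prob_from_0[OF v, of 0 t] notin unfolding w out_prob_R3_qfst R3_def by auto
  qed
  have "computes_with_prob R3_qfst R3 (4/7 - \<epsilon>)"
    unfolding computes_with_prob_def R3_qfst_simps
  proof (intro conjI ballI impI)
    show "1/2 < 4/7 - \<epsilon>" using assms by simp
  next
    fix v w assume "(v, w) \<in> R3"
    then show "4/7 - \<epsilon> \<le> out_prob R3_qfst w v" using acc[of v w] assms by linarith
  next
    fix v w assume "v \<in> lists {0, 1, 2}" "w \<in> lists {3}" "(v, w) \<notin> R3"
    then show "out_prob R3_qfst w v \<le> 1 - (4/7 - \<epsilon>)" using rej[of v w] assms by linarith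
  qed
  then show ?thesis
    using is_qfst_R3_qfst by (intro exI[of _ R3_qfst]) simp
qed

end
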